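(* Let $P$ be a pospace equipped with the upper convexity (resp. the lower convexity, resp. the order convexity), and let $K$ be a closed convex subset of $P$. Then, for every compact subset $A$ of $K$ such that $K=\overline{\operatorname{co}}(A)$, we have $A\supset\operatorname{ex}K$.
   Context: A pospace is a poset $P$ equipped with a topology such that the partial order $\{(x,y):x\leqslant y\}$ is closed in $P\times P$. For $A\subset P$, $\uparrow A$ and $\downarrow A$ denote the upper and lower subsets generated by $A$. In the upper (resp. lower) convexity the convex subsets are the upper (resp. lower) subsets of $P$; in the order convexity the convex subsets are the order-convex ones, i.e. the sets $C$ such that $x\leqslant y\leqslant z$ and $x,z\in C$ imply $y\in C$. $\operatorname{co}(A)$ is the intersection of all convex subsets containing $A$, and $\overline{\operatorname{co}}(A)$ is the topological closure of $\operatorname{co}(A)$. A point $x\in K$ is an extreme point of $K$ if $x\notin\operatorname{co}(K\setminus\{x\})$; $\operatorname{ex}K$ is the set of extreme points of $K$. *)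

theory Defs
  imports "HOL-Analysis.Analysis"
begin

text \<open>A convexity is represented by its predicate of convex sets, so that the convex hull operator
  of the convexity \<open>conv\<close> is the library's \<open>conv hull A\<close>.\<close>

definition upper_convex :: "'a::order set \<Rightarrow> bool"
  where "upper_convex C \<longleftrightarrow> (\<forall>x y. x \<in> C \<longrightarrow> x \<le> y \<longrightarrow> y \<in> C)"

definition lower_convex :: "'a::order set \<Rightarrow> bool"
  where "lower_convex C \<longleftrightarrow> (\<forall>x y. y \<in> C \<longrightarrow> x \<le> y \<longrightarrow> x \<in> C)"

definition order_convex :: "'a::order set \<Rightarrow> bool"
  where "order_convex C \<longleftrightarrow> (\<forall>x y z. x \<le> y \<longrightarrow> y \<le> z \<longrightarrow> x \<in> C \<longrightarrow> z \<in> C \<longrightarrow> y \<in> C)"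

definition extreme_points :: "('a set \<Rightarrow> bool) \<Rightarrow> 'a set \<Rightarrow> 'a set"
  where "extreme_points conv K = {x \<in> K. x \<notin> conv hull (K - {x})}"

end

theory Submission
  imports Defs
begin

text \<open>
  The convex hulls of the three convexities are \<open>\<up>A\<close>, \<open>\<down>A\<close> and \<open>\<up>A \<inter> \<down>A\<close>. In a pospace each of
  them is closed as soon as \<open>A\<close> is compact, since \<open>\<up>A\<close> and \<open>\<down>A\<close> are images of a compact set under
  a closed relation (\<open>closed_Image_compact\<close>). Hence \<open>K\<close> is the convex hull of \<open>A\<close> itself, with no
  closure involved. The claim is then purely algebraic: an extreme point \<open>x\<close> of \<open>K\<close> outside \<open>A\<close>
  would give \<open>A \<subseteq> K - {x}\<close>, so \<open>x\<close>, being in the hull of \<open>A\<close>, would be in the hull of \<open>K - {x}\<close>.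
\<close>

lemma closed_converse:
  fixes R :: "('a::topological_space \<times> 'b::topological_space) set"
  assumes "closed R"
  shows "closed (R\<inverse>)"
proof -
  have "R\<inverse> = prod.swap -` R"
    by auto
  moreover have "continuous_on UNIV (prod.swap :: 'b \<times> 'a \<Rightarrow> 'a \<times> 'b)"
    by (rule continuous_on_swap)
  ultimately show ?thesis
    using closed_vimage[OF assms] by metis
qed

text \<open>If \<open>y\<close> lies outside \<open>R `` A\<close>, then \<open>A \<times> {y}\<close> misses the closed set \<open>R\<close>, and by compactness
  of \<open>A\<close> so does a whole tube \<open>A \<times> T\<close> around it; hence \<open>T\<close>
  misses \<open>R `` A\<close>.\<close>

lemma closed_Image_compact:
  fixes R :: "('a::topological_space \<times> 'b::topological_space) set"
  assumes "closed R" and "compact A"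
  shows "closed (R `` A)"
proof -
  have "\<exists>T. open T \<and> y \<in> T \<and> T \<subseteq> - (R `` A)" if "y \<in> - (R `` A)" for y
  proof -
    have "open (- (R\<inverse>))"
      using closed_converse[OF \<open>closed R\<close>] by (simp add: open_Compl)
    moreover have "{y} \<times> A \<subseteq> - (R\<inverse>)"
      using that by blast
    ultimately obtain T where "y \<in> T" "open T" "T \<times> A \<subseteq> - (R\<inverse>)"
      using Elementary_Topology.tube_lemma[OF \<open>compact A\<close>] by metis
    then show ?thesis
      by blast
  qed
  then have "open (- (R `` A))"
    by (rule Topological_Spaces.openI)
  then show ?thesis
    by (simp add: closed_def)
qed

lemma upper_convex_hull: "upper_convex hull A = {(x, y). x \<le> y} `` A"
proof (rule hull_unique)
  show "upper_convex ({(x, y). x \<le> y} `` A)"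
    unfolding upper_convex_def by (blast dest: order_trans)
qed (unfold upper_convex_def, blast+)

lemma lower_convex_hull: "lower_convex hull A = {(x, y). x \<le> y}\<inverse> `` A"
proof (rule hull_unique)
  show "lower_convex ({(x, y). x \<le> y}\<inverse> `` A)"
    unfolding lower_convex_def by (blast dest: order_trans)
qed (unfold lower_convex_def, blast+)

lemma order_convex_hull:
  "order_convex hull A = {(x, y). x \<le> y} `` A \<inter> {(x, y). x \<le> y}\<inverse> `` A"
proof (rule hull_unique)
  show "order_convex ({(x, y). x \<le> y} `` A \<inter> {(x, y). x \<le> y}\<inverse> `` A)"
    unfolding order_convex_def by (blast dest: order_trans)
next
  fix C assume "A \<subseteq> C" "order_convex C"
  then show "{(x, y). x \<le> y} `` A \<inter> {(x, y). x \<le> y}\<inverse> `` A \<subseteq> C"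
    unfolding order_convex_def by blast
qed auto

lemma closed_hull_of_compact:
  fixes conv :: "'a::{order, topological_space} set \<Rightarrow> bool"
  assumes "closed {(x::'a, y). x \<le> y}"
    and "conv = upper_convex \<or> conv = lower_convex \<or> conv = order_convex"
    and "compact A"
  shows "closed (conv hull A)"
  using assms(2)
    closed_Image_compact[OF assms(1,3)]
    closed_Image_compact[OF closed_converse[OF assms(1)] assms(3)]
  by (auto simp only: upper_convex_hull lower_convex_hull order_convex_hull)

text \<open>The hull of \<open>A\<close> is generated by \<open>A\<close>, and an extreme point is not generated by the
  remaining points of the set, so it must itself be one of the generators. This holds in every
  convexity.\<close>

lemma extreme_points_hull_subset: "extreme_points conv (conv hull A) \<subseteq> A"
proof
  fix x assume x: "x \<in> extreme_points conv (conv hull A)"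
  show "x \<in> A"
  proof (rule ccontr)
    assume "x \<notin> A"
    then have "A \<subseteq> conv hull A - {x}"
      using hull_subset[of A conv] by auto
    then have "conv hull A \<subseteq> conv hull (conv hull A - {x})"
      by (rule hull_mono)
    then show False
      using x by (auto simp: extreme_points_def)
  qed
qed

theorem theorem3p5:
  fixes conv :: "'a::{order, topological_space} set \<Rightarrow> bool" and K A :: "'a set"
  assumes "closed {(x::'a, y). x \<le> y}"
    and "conv = upper_convex \<or> conv = lower_convex \<or> conv = order_convex"
    and "closed K" and "conv K"
    and "compact A" and "A \<subseteq> K" and "K = closure (conv hull A)"
  shows "extreme_points conv K \<subseteq> A"
proof -
  have "K = conv hull A"
    using closed_hull_of_compact[OF assms(1,2,5)] assms(7) by simp
  then show ?thesis
    using extreme_points_hull_subset by simp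
qed

end
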